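(* Let $k \in \mathbb{N}_0$ and let $G$ be a perfect graph. Then $G \in F(\omega,k)$ if and only if $G \in F(\chi,k)$. In particular, if all graphs in $F(\omega,k)$ are perfect, then $F(\omega,k)=F(\chi,k)$.
   Context: All graphs are finite and simple. $\Delta(H)$, $\omega(H)$, $\chi(H)$ denote maximum degree, clique number and chromatic number. A graph is perfect if $\omega(H)=\chi(H)$ for every induced subgraph $H$. For $k\in\mathbb{N}_0$: $\varOmega_k$ is the class of graphs $G$ such that every induced subgraph $H$ of $G$ (including $G$) satisfies $\Delta(H)\le\omega(H)+k-1$; $\varUpsilon_k$ is the class of graphs $G$ such that every induced subgraph $H$ of $G$ (including $G$) satisfies $\Delta(H)\le\chi(H)+k-1$. $F(\omega,k)$ (resp. $F(\chi,k)$) is the set of minimal forbidden induced subgraphs of $\varOmega_k$ (resp. $\varUpsilon_k$): graphs not in the class all of whose proper induced subgraphs are in the class (up to isomorphism). *)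

theory Defs
  imports "Graph_Theory.Digraph_Component"
begin

text \<open>
  Finite simple graphs are the non-null members of the locale \<^locale>\<open>graph\<close>: finite symmetric
  loop-free digraphs without parallel arcs, an undirected edge being a pair of opposite arcs.
  The null graph is excluded, also as an induced subgraph: it has maximum degree, clique number and
  chromatic number 0, so for \<open>k = 0\<close> it would violate \<open>\<Delta> \<le> \<omega> + k - 1\<close> and
  make both classes below empty.
\<close>

definition simple_graph :: "('a, 'b) pre_digraph \<Rightarrow> bool" where
  "simple_graph G \<longleftrightarrow> graph G \<and> verts G \<noteq> {}"

definition induced_subgraphs :: "('a, 'b) pre_digraph \<Rightarrow> ('a, 'b) pre_digraph set" where
  "induced_subgraphs G = {H. induced_subgraph H G \<and> verts H \<noteq> {}}"

text \<open>In a symmetric digraph without parallel arcs, the out-degree is the number of neighbours.\<close>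

definition max_degree :: "('a, 'b) pre_digraph \<Rightarrow> nat" where
  "max_degree G = Max (out_degree G ` verts G)"

definition clique :: "('a, 'b) pre_digraph \<Rightarrow> 'a set \<Rightarrow> bool" where
  "clique G S \<longleftrightarrow> S \<subseteq> verts G \<and> (\<forall>u\<in>S. \<forall>v\<in>S. u \<noteq> v \<longrightarrow> u \<rightarrow>\<^bsub>G\<^esub> v)"

definition clique_number :: "('a, 'b) pre_digraph \<Rightarrow> nat" where
  "clique_number G = Max {card S | S. clique G S}"

definition coloring :: "('a, 'b) pre_digraph \<Rightarrow> nat \<Rightarrow> ('a \<Rightarrow> nat) \<Rightarrow> bool" where
  "coloring G n c \<longleftrightarrow> (\<forall>v\<in>verts G. c v < n) \<and> (\<forall>u v. u \<rightarrow>\<^bsub>G\<^esub> v \<longrightarrow> c u \<noteq> c v)"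

definition chromatic_number :: "('a, 'b) pre_digraph \<Rightarrow> nat" where
  "chromatic_number G = (LEAST n. \<exists>c. coloring G n c)"

definition perfect_graph :: "('a, 'b) pre_digraph \<Rightarrow> bool" where
  "perfect_graph G \<longleftrightarrow>
     simple_graph G \<and> (\<forall>H\<in>induced_subgraphs G. clique_number H = chromatic_number H)"

definition Omega_class :: "nat \<Rightarrow> ('a, 'b) pre_digraph set" where
  "Omega_class k = {G. simple_graph G \<and>
     (\<forall>H\<in>induced_subgraphs G. int (max_degree H) \<le> int (clique_number H) + int k - 1)}"

definition Upsilon_class :: "nat \<Rightarrow> ('a, 'b) pre_digraph set" where
  "Upsilon_class k = {G. simple_graph G \<and>
     (\<forall>H\<in>induced_subgraphs G. int (max_degree H) \<le> int (chromatic_number H) + int k - 1)}"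

text \<open>
  Instead of one representative per isomorphism type, the sets of minimal forbidden induced
  subgraphs contain every graph over the given types with the defining property. Every finite
  simple graph has an isomorphic copy with vertices in \<^typ>\<open>nat\<close> and arcs in
  \<^typ>\<open>nat \<times> nat\<close>.
\<close>

definition minimal_forbidden :: "('a, 'b) pre_digraph set \<Rightarrow> ('a, 'b) pre_digraph set" where
  "minimal_forbidden C =
     {G. simple_graph G \<and> G \<notin> C \<and> (\<forall>H\<in>induced_subgraphs G. H \<noteq> G \<longrightarrow> H \<in> C)}"

definition F_omega :: "nat \<Rightarrow> ('a, 'b) pre_digraph set" where
  "F_omega k = minimal_forbidden (Omega_class k)"

definition F_chi :: "nat \<Rightarrow> ('a, 'b) pre_digraph set" where
  "F_chi k = minimal_forbidden (Upsilon_class k)"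

end

theory Submission
  imports Defs
begin

text \<open>
  For a perfect graph both classes, and hence both minimality conditions, coincide on all induced
  subgraphs. Because \<open>\<omega> \<le> \<chi>\<close>, the class \<open>\<Omega>\<^sub>k\<close> is contained in \<open>\<Upsilon>\<^sub>k\<close>, so every
  \<open>G \<in> F(\<chi>,k)\<close> contains some \<open>H \<in> F(\<omega>,k)\<close>; if \<open>H\<close> is perfect, then \<open>H \<in> F(\<chi>,k)\<close>, and
  minimality of \<open>G\<close> forces \<open>H = G\<close>.
\<close>

lemma induced_subgraph_trans:
  assumes "induced_subgraph H G" "induced_subgraph K H"
  shows "induced_subgraph K G"
  using assms unfolding induced_subgraph_def subgraph_def compatible_def by auto

lemma simple_graph_induced_subgraph:
  assumes "simple_graph G" "H \<in> induced_subgraphs G"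
  shows "simple_graph H"
proof -
  have G: "graph G" and H: "induced_subgraph H G" and ne: "verts H \<noteq> {}"
    using assms by (auto simp: simple_graph_def induced_subgraphs_def)
  interpret graph G by (fact G)
  have "digraph H" using H by (simp add: induced_subgraph_def digraph_subgraph)
  moreover have "symmetric H" using H induced_graph_imp_symmetric sym_arcs by blast
  ultimately have "graph H" by (rule digraph.graphI)
  then show ?thesis using ne by (simp add: simple_graph_def)
qed

lemma induced_subgraphs_self: "simple_graph G \<Longrightarrow> G \<in> induced_subgraphs G"
  unfolding simple_graph_def induced_subgraphs_def induced_subgraph_def
  by (auto simp: subgraph_def compatible_def graph_def digraph_def fin_digraph_def wf_digraph_def)

lemma induced_subgraphs_mono:
  "H \<in> induced_subgraphs G \<Longrightarrow> induced_subgraphs H \<subseteq> induced_subgraphs G"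
  using induced_subgraph_trans unfolding induced_subgraphs_def by blast

text \<open>An induced subgraph is determined by its vertex set, so a proper one must lose a vertex.
  This makes the number of vertices a measure for descending to minimal graphs.\<close>

lemma card_verts_induced_subgraph_less:
  assumes "simple_graph G" "H \<in> induced_subgraphs G" "H \<noteq> G"
  shows "card (verts H) < card (verts G)"
proof -
  interpret graph G using assms(1) by (simp add: simple_graph_def)
  have H: "induced_subgraph H G" using assms(2) by (simp add: induced_subgraphs_def)
  then have sub: "verts H \<subseteq> verts G" by (auto simp: induced_subgraph_def subgraph_def)
  have "verts H \<noteq> verts G"
  proof
    assume eq: "verts H = verts G"
    have "arcs H = arcs G"
      using H eq by (auto simp: induced_subgraph_def)
    \<comment> \<open>Compatibility equates the \<open>tail\<close> and \<open>head\<close> maps as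
      total functions, so equal vertices and arcs already give equal records.\<close>
    with H eq have "H = G"
      by (auto simp: induced_subgraph_def subgraph_def compatible_def intro: pre_digraph.equality)
    with assms(3) show False ..
  qed
  with sub show ?thesis by (simp add: psubset_card_mono psubset_eq)
qed

lemma perfect_graph_induced_subgraph:
  assumes "perfect_graph G" "H \<in> induced_subgraphs G"
  shows "perfect_graph H"
  using assms induced_subgraphs_mono simple_graph_induced_subgraph
  unfolding perfect_graph_def by blast

text \<open>Vertices of a clique are pairwise adjacent, so an optimal colouring is injective on it
  and uses at least as many colours as the clique has vertices.\<close>

lemma clique_number_le_chromatic_number:
  assumes "simple_graph G"
  shows "clique_number G \<le> chromatic_number G"
proof -
  interpret graph G using assms by (simp add: simple_graph_def)
  \<comment> \<open>Numbering the vertices is a proper colouring because there are no loops. Hence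
    the \<open>LEAST\<close> in \<open>chromatic_number\<close> ranges over a nonempty set and is
    attained.\<close>
  obtain h where h: "bij_betw h (verts G) {0..<card (verts G)}"
    using ex_bij_betw_finite_nat finite_verts by blast
  have "coloring G (card (verts G)) h"
    unfolding coloring_def
  proof (intro conjI ballI allI impI)
    fix v assume "v \<in> verts G"
    then show "h v < card (verts G)" using h by (auto dest: bij_betwE)
  next
    fix u v assume uv: "u \<rightarrow>\<^bsub>G\<^esub> v"
    then have "u \<noteq> v" "u \<in> verts G" "v \<in> verts G"
      using adj_not_same by auto
    then show "h u \<noteq> h v"
      using h by (auto simp: bij_betw_def inj_on_def)
  qed
  then obtain c where c: "coloring G (chromatic_number G) c"
    unfolding chromatic_number_def using LeastI_ex[of "\<lambda>n. \<exists>c. coloring G n c"] by blast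
  have "card S \<le> chromatic_number G" if S: "clique G S" for S
  proof -
    have "inj_on c S"
    proof (rule inj_onI, rule ccontr)
      fix x y assume "x \<in> S" "y \<in> S" "c x = c y" "x \<noteq> y"
      then show False using S c unfolding clique_def coloring_def by metis
    qed
    moreover have "c ` S \<subseteq> {..<chromatic_number G}"
      using S c unfolding clique_def coloring_def by auto
    ultimately show ?thesis using card_inj_on_le[of c S "{..<chromatic_number G}"] by simp
  qed
  moreover have "finite {card S | S. clique G S}"
    by (rule finite_subset[of _ "card ` Pow (verts G)"]) (auto simp: clique_def)
  \<comment> \<open>The empty clique guarantees that \<open>Max\<close> is taken over a nonempty
    set.\<close>
  moreover have "clique G {}" by (simp add: clique_def)
  ultimately show ?thesis unfolding clique_number_def by (subst Max_le_iff) auto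
qed

lemma Omega_class_subset_Upsilon_class: "Omega_class k \<subseteq> Upsilon_class k"
  using clique_number_le_chromatic_number simple_graph_induced_subgraph
  unfolding Omega_class_def Upsilon_class_def by fastforce

lemma perfect_graph_Omega_class_iff_Upsilon_class:
  "perfect_graph G \<Longrightarrow> G \<in> Omega_class k \<longleftrightarrow> G \<in> Upsilon_class k"
  unfolding perfect_graph_def Omega_class_def Upsilon_class_def by simp

lemma perfect_graph_F_omega_iff_F_chi:
  "perfect_graph G \<Longrightarrow> G \<in> F_omega k \<longleftrightarrow> G \<in> F_chi k"
  using perfect_graph_Omega_class_iff_Upsilon_class perfect_graph_induced_subgraph
  unfolding F_omega_def F_chi_def minimal_forbidden_def by blast

text \<open>Descent for an arbitrary class \<open>C\<close>: a graph outside \<open>C\<close> that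
  is not minimal has a proper induced subgraph outside \<open>C\<close>, which has fewer vertices,
  so the search ends.\<close>

lemma obtain_minimal_forbidden:
  assumes "simple_graph G" "G \<notin> C"
  obtains H where "H \<in> induced_subgraphs G" "H \<in> minimal_forbidden C"
proof -
  have "\<exists>H\<in>induced_subgraphs G. H \<in> minimal_forbidden C"
    using assms
  proof (induction "card (verts G)" arbitrary: G rule: less_induct)
    case less
    show ?case
    proof (cases "G \<in> minimal_forbidden C")
      case True
      then show ?thesis using induced_subgraphs_self less.prems(1) by blast
    next
      case False
      then obtain K where K: "K \<in> induced_subgraphs G" "K \<noteq> G" "K \<notin> C"
        using less.prems unfolding minimal_forbidden_def by blast
      with less.hyps[of K] less.prems(1)
      obtain H where "H \<in> induced_subgraphs K" "H \<in> minimal_forbidden C"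
        using card_verts_induced_subgraph_less simple_graph_induced_subgraph by blast
      with K(1) show ?thesis using induced_subgraphs_mono by blast
    qed
  qed
  then show thesis using that by blast
qed

theorem theorem3:
  fixes k :: nat
  shows "(\<forall>G :: ('a, 'b) pre_digraph. perfect_graph G \<longrightarrow> (G \<in> F_omega k \<longleftrightarrow> G \<in> F_chi k)) \<and>
         ((\<forall>G \<in> (F_omega k :: ('a, 'b) pre_digraph set). perfect_graph G) \<longrightarrow>
           (F_omega k :: ('a, 'b) pre_digraph set) = F_chi k)"
proof (intro conjI impI allI)
  fix G :: "('a, 'b) pre_digraph"
  assume "perfect_graph G"
  then show "G \<in> F_omega k \<longleftrightarrow> G \<in> F_chi k"
    by (rule perfect_graph_F_omega_iff_F_chi)
next
  assume perf: "\<forall>G \<in> (F_omega k :: ('a, 'b) pre_digraph set). perfect_graph G"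
  have "G \<in> F_omega k" if G: "G \<in> F_chi k" for G :: "('a, 'b) pre_digraph"
  proof -
    have "simple_graph G" "G \<notin> Omega_class k"
      using G Omega_class_subset_Upsilon_class
      unfolding F_chi_def minimal_forbidden_def by blast+
    then obtain H where H: "H \<in> induced_subgraphs G" "H \<in> F_omega k"
      unfolding F_omega_def by (rule obtain_minimal_forbidden)
    \<comment> \<open>Perfection is available for \<open>H\<close>, as a member of
      \<open>F_omega k\<close>, while for \<open>G\<close> it is not yet known.\<close>
    with perf have "H \<in> F_chi k"
      using perfect_graph_F_omega_iff_F_chi by blast
    \<comment> \<open>Otherwise minimality of \<open>G\<close> would put \<open>H\<close> into
      \<open>Upsilon_class k\<close>, which members of \<open>F_chi k\<close> avoid.\<close>
    with G H(1) have "H = G"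
      unfolding F_chi_def minimal_forbidden_def by blast
    with H(2) show ?thesis by simp
  qed
  with perf show "(F_omega k :: ('a, 'b) pre_digraph set) = F_chi k"
    using perfect_graph_F_omega_iff_F_chi by blast
qed

end
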